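(* Let $s\in[0,2)$, $-\infty<t_1<t_2<\infty$, and let $y\in C^\infty([t_1,t_2])$ satisfy, for some constants $M,R>0$, $$|y^{(i)}(t)|\le M\frac{(i!)^s}{R^i}\qquad \forall i\ge 0,\ \forall t\in[t_1,t_2].$$ Then the function $$\theta(t,x)=\sum_{i\ge 0}\frac{x^{2i}}{(2i)!}\,y^{(i)}(t)$$ is well defined and Gevrey of order $s$ in $t$ and $s/2$ in $x$ on $[t_1,t_2]\times[0,1]$; hence the control $$u(t)=\partial_x\theta(t,1)=\sum_{i\ge 1}\frac{y^{(i)}(t)}{(2i-1)!}$$ is also Gevrey of order $s$ on $[t_1,t_2]$.
   Context: Gevrey functions: a function $y\in C^\infty([a,b])$ is Gevrey of order $s\ge 0$ on $[a,b]$ if there are constants $M,R>0$ with $|y^{(p)}(t)|\le M\,(p!)^s/R^p$ for all $t\in[a,b]$, $p\ge 0$. More generally, if $K\subset\mathbb{R}^d$ is compact and $y$ is of class $C^\infty$ on $K$ (i.e. the restriction to $K$ of a $C^\infty$ function on an open neighbourhood of $K$), $y$ is Gevrey of order $s_1$ in $x_1$, ..., $s_d$ in $x_d$ on $K$ if there are constants $M,R_1,\dots,R_d>0$ such that $|\partial_{x_1}^{p_1}\cdots\partial_{x_d}^{p_d}y(x)|\le M\prod_{i=1}^d (p_i!)^{s_i}/R_i^{p_i}$ for all $x\in K$ and $p\in\mathbb{N}^d$. *)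

theory Defs
  imports "HOL-Analysis.Analysis"
begin

definition partial_deriv :: "'a::euclidean_space \<Rightarrow> ('a \<Rightarrow> real) \<Rightarrow> 'a \<Rightarrow> real" where
  "partial_deriv b f x = deriv (\<lambda>h. f (x + h *\<^sub>R b)) 0"

text \<open>The word \<open>[b1, ..., bn]\<close> of coordinate directions stands for the operator
  \<open>\<partial>_b1 ... \<partial>_bn\<close>. Its multi-index is \<open>p_b = count_list bs b\<close>. On a function of class
  \<open>C^\<infinity>\<close> the order of the letters is immaterial.\<close>

definition iter_partial :: "'a::euclidean_space list \<Rightarrow> ('a \<Rightarrow> real) \<Rightarrow> 'a \<Rightarrow> real" where
  "iter_partial bs f = foldr partial_deriv bs f"

definition smooth_on_open :: "'a::euclidean_space set \<Rightarrow> ('a \<Rightarrow> real) \<Rightarrow> bool" where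
  "smooth_on_open U f \<longleftrightarrow> open U \<and>
     (\<forall>bs \<in> lists Basis.
        continuous_on U (iter_partial bs f) \<and>
        (\<forall>x \<in> U. \<forall>b \<in> Basis.
           (\<lambda>h. iter_partial bs f (x + h *\<^sub>R b)) differentiable (at 0)))"

definition smooth_extension :: "'a::euclidean_space set \<Rightarrow> ('a \<Rightarrow> real) \<Rightarrow> ('a \<Rightarrow> real) \<Rightarrow> bool" where
  "smooth_extension K y Y \<longleftrightarrow>
     (\<exists>U. K \<subseteq> U \<and> smooth_on_open U Y) \<and> (\<forall>x \<in> K. Y x = y x)"

definition smooth_on_compact :: "'a::euclidean_space set \<Rightarrow> ('a \<Rightarrow> real) \<Rightarrow> bool" where
  "smooth_on_compact K y \<longleftrightarrow> (\<exists>Y. smooth_extension K y Y)"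

text \<open>The orders and the radii are vectors with one component per coordinate: in \<open>real\<close> the order
  is a number \<open>s\<close>, and in \<open>real \<times> real\<close> a pair \<open>(s1, s2)\<close>. The derivatives of \<open>y\<close> at
  points of \<open>K\<close> are those of an extension \<open>Y\<close>; if \<open>K\<close> is the closure of its interior, they do not
  depend on the choice of \<open>Y\<close>. The intended use is for compact \<open>K\<close> and nonnegative orders.\<close>

definition gevrey_on :: "'a::euclidean_space \<Rightarrow> 'a set \<Rightarrow> ('a \<Rightarrow> real) \<Rightarrow> bool" where
  "gevrey_on s K y \<longleftrightarrow>
     (\<exists>Y. smooth_extension K y Y \<and>
        (\<exists>M R. M > 0 \<and> (\<forall>b \<in> Basis. R \<bullet> b > 0) \<and>
           (\<forall>x \<in> K. \<forall>bs \<in> lists Basis.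
              \<bar>iter_partial bs Y x\<bar> \<le>
                M * (\<Prod>b \<in> Basis. fact (count_list bs b) powr (s \<bullet> b) / (R \<bullet> b) ^ count_list bs b))))"

text \<open>For a function given on \<open>{a..b}\<close> with \<open>a < b\<close>, iterating \<open>deriv_in {a..b}\<close> yields the
  derivatives \<open>y^(i)\<close> on the closed interval, one-sided at the end points. They agree on \<open>{a..b}\<close>
  with the derivatives of any smooth extension.\<close>

definition deriv_in :: "real set \<Rightarrow> (real \<Rightarrow> real) \<Rightarrow> real \<Rightarrow> real" where
  "deriv_in S f t = vector_derivative f (at t within S)"

definition theta :: "real \<Rightarrow> real \<Rightarrow> (real \<Rightarrow> real) \<Rightarrow> real \<times> real \<Rightarrow> real" where
  "theta t1 t2 y = (\<lambda>(t, x). \<Sum>i. x ^ (2 * i) / fact (2 * i) * (deriv_in {t1..t2} ^^ i) y t)"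

definition control :: "real \<Rightarrow> real \<Rightarrow> (real \<Rightarrow> real) \<Rightarrow> real \<Rightarrow> real" where
  "control t1 t2 y t = deriv_in {0..1} (\<lambda>x. theta t1 t2 y (t, x)) 1"

end

theory Submission
  imports Defs
begin

text \<open>
  On \<open>[t1, t2] \<times> [0, 1]\<close> the estimates come from differentiating the series termwise, with
  \<open>(i + p)! \<le> 2 ^ (i + p) * i! * p!\<close> and \<open>(i!)\<^sup>2 \<le> (2 * i)!\<close>; the remaining series
  \<open>\<Sum>n. c ^ n / (n!) powr (1 - s / 2)\<close> converges because \<open>s < 2\<close>.

  The given smooth extension of \<open>y\<close> has no Gevrey bounds outside \<open>[t1, t2]\<close>, so its derivatives
  cannot be inserted into the series to extend \<open>\<theta>\<close>. Instead each coefficient \<open>y^(i)\<close> is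
  extended separately to a function \<open>g_i\<close> on a common larger interval, such that \<open>g_i\<close> and its
  derivatives up to an order \<open>m_i\<close> are at most \<open>(2 * i)! / 32 ^ i\<close>. This is possible with
  \<open>m_i \<rightarrow> \<infinity>\<close>, again because \<open>s < 2\<close>, so that every termwise derivative of
  \<open>\<Sum>i. x ^ (2 * i) / (2 * i)! * g_i(t)\<close> converges uniformly for \<open>\<bar>x\<bar> \<le> 2\<close>.
\<close>

section \<open>Sequences of iterated derivatives\<close>

text \<open>Carrying all derivatives as data lets products and antiderivatives be formed without a
  derivative operator. At the end points of a closed interval the derivatives are one-sided.\<close>

definition deriv_seq :: "real set \<Rightarrow> (nat \<Rightarrow> real \<Rightarrow> real) \<Rightarrow> bool" where
  "deriv_seq S f \<longleftrightarrow> (\<forall>n. \<forall>x \<in> S. (f n has_real_derivative f (Suc n) x) (at x within S))"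

lemma deriv_seqD: "deriv_seq S f \<Longrightarrow> x \<in> S \<Longrightarrow> (f n has_real_derivative f (Suc n) x) (at x within S)"
  by (simp add: deriv_seq_def)

lemma deriv_seq_subset: "deriv_seq S f \<Longrightarrow> T \<subseteq> S \<Longrightarrow> deriv_seq T f"
  unfolding deriv_seq_def by (meson DERIV_subset subsetD)

lemma deriv_seq_shift: "deriv_seq S f \<Longrightarrow> deriv_seq S (\<lambda>n. f (n + k))"
  by (simp add: deriv_seq_def)

lemma deriv_seq_continuous: "deriv_seq S f \<Longrightarrow> continuous_on S (f n)"
  by (auto intro!: DERIV_continuous simp: deriv_seq_def continuous_on_eq_continuous_within)

lemma deriv_in_eq_on:
  assumes "\<And>x. x \<in> S \<Longrightarrow> f x = g x" "t \<in> S"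
  shows "deriv_in S f t = deriv_in S g t"
  unfolding deriv_in_def
  using assms by (intro vector_derivative_cong_eq always_eventually) auto

lemma deriv_in_eq:
  assumes "a < b" "t \<in> {a..b}" "(f has_real_derivative d) (at t within {a..b})"
  shows "deriv_in {a..b} f t = d"
  using assms unfolding deriv_in_def
  by (intro vector_derivative_within_closed_interval)
    (auto simp: has_real_derivative_iff_has_vector_derivative)

lemma deriv_in_funpow_eq:
  assumes "a < b" "deriv_seq {a..b} f" "\<And>t. t \<in> {a..b} \<Longrightarrow> y t = f 0 t" "t \<in> {a..b}"
  shows "(deriv_in {a..b} ^^ n) y t = f n t"
  using assms(4)
proof (induction n arbitrary: t)
  case (Suc n)
  have "(deriv_in {a..b} ^^ Suc n) y t = deriv_in {a..b} (f n) t"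
    using Suc by (auto intro: deriv_in_eq_on)
  also have "\<dots> = f (Suc n) t"
    using assms(1) Suc.prems deriv_seqD[OF assms(2)] by (intro deriv_in_eq) auto
  finally show ?case .
qed (use assms in auto)

text \<open>Derivatives within a nondegenerate interval are unique. Later this turns agreement of an
  extension with \<open>y^(i)\<close> on \<open>{a..b}\<close> into agreement of all derivatives
  there.\<close>

lemma deriv_seq_unique:
  assumes "a < b" "deriv_seq {a..b} f" "deriv_seq {a..b} g"
    "\<And>t. t \<in> {a..b} \<Longrightarrow> f 0 t = g 0 t" "t \<in> {a..b}"
  shows "f n t = g n t"
  using deriv_in_funpow_eq[of a b f "f 0" t n] deriv_in_funpow_eq[of a b g "f 0" t n] assms by auto

text \<open>\<open>leibniz n f g i j\<close> is the \<open>n\<close>-th derivative of \<open>f i * g j\<close>.\<close>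

fun leibniz :: "nat \<Rightarrow> (nat \<Rightarrow> real \<Rightarrow> real) \<Rightarrow> (nat \<Rightarrow> real \<Rightarrow> real) \<Rightarrow> nat \<Rightarrow> nat \<Rightarrow> real \<Rightarrow> real" where
  "leibniz 0 f g i j x = f i x * g j x"
| "leibniz (Suc n) f g i j x = leibniz n f g (Suc i) j x + leibniz n f g i (Suc j) x"

text \<open>The recursion of \<open>leibniz\<close> is the product rule itself, so induction with
  \<open>i\<close> and \<open>j\<close> arbitrary replaces the binomial formula.\<close>

lemma deriv_seq_leibniz:
  assumes "deriv_seq S f" "deriv_seq S g"
  shows "deriv_seq S (\<lambda>n. leibniz n f g 0 0)"
proof -
  have "(leibniz n f g i j has_real_derivative leibniz (Suc n) f g i j x) (at x within S)"
    if "x \<in> S" for n i j x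
  proof (induction n arbitrary: i j)
    case 0
    have "((\<lambda>x. f i x * g j x) has_real_derivative leibniz (Suc 0) f g i j x) (at x within S)"
      by (rule derivative_eq_intros deriv_seqD[OF assms(1)] deriv_seqD[OF assms(2)] that)+ simp
    then show ?case by simp
  next
    case (Suc n)
    have "((\<lambda>x. leibniz n f g (Suc i) j x + leibniz n f g i (Suc j) x)
        has_real_derivative leibniz (Suc (Suc n)) f g i j x) (at x within S)"
      by (rule derivative_eq_intros Suc)+ simp
    then show ?case by simp
  qed
  then show ?thesis unfolding deriv_seq_def by blast
qed

lemma deriv_seq_mult_power:
  assumes "deriv_seq S f" "deriv_seq S g"
  shows "\<exists>h. deriv_seq S h \<and> (\<forall>x. h 0 x = f 0 x * g 0 x ^ N)"
proof (induction N)
  case 0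
  then show ?case using assms(1) by auto
next
  case (Suc N)
  then obtain h where h: "deriv_seq S h" "\<forall>x. h 0 x = f 0 x * g 0 x ^ N" by blast
  then show ?case
    by (intro exI[of _ "\<lambda>n. leibniz n h g 0 0"]) (auto intro: deriv_seq_leibniz assms(2))
qed

text \<open>\<open>flat_fun n\<close> is the \<open>n\<close>-th derivative of the function \<open>exp (- 1 / u)\<close>, extended by zero to
  \<open>u \<le> 0\<close>.\<close>

fun flat_poly :: "nat \<Rightarrow> real poly" where
  "flat_poly 0 = 1"
| "flat_poly (Suc n) = [:0, 0, 1:] * (flat_poly n - pderiv (flat_poly n))"

definition flat_fun :: "nat \<Rightarrow> real \<Rightarrow> real" where
  "flat_fun n u = (if u > 0 then poly (flat_poly n) (inverse u) * exp (- inverse u) else 0)"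

lemma tendsto_poly_mult_exp_minus: "((\<lambda>x. poly p x * exp (- x)) \<longlongrightarrow> (0::real)) at_top"
proof -
  have "((\<lambda>x. \<Sum>i\<le>degree p. coeff p i * (x ^ i / exp x)) \<longlongrightarrow> (\<Sum>i\<le>degree p. coeff p i * 0)) at_top"
    by (intro tendsto_sum tendsto_mult tendsto_const tendsto_power_div_exp_0)
  then show ?thesis
    by (simp add: poly_altdef exp_minus divide_inverse sum_distrib_right mult.assoc)
qed

lemma flat_fun_has_derivative: "(flat_fun n has_real_derivative flat_fun (Suc n) u) (at u)"
proof -
  consider "u > 0" | "u < 0" | "u = 0" by linarith
  then show ?thesis
  proof cases
    case 1
    \<comment> \<open>With \<open>v = 1 / u\<close> and \<open>dv/du = - v^2\<close>, the derivative
      of \<open>p(v) exp(-v)\<close> is \<open>v^2 (p(v) - p'(v)) exp(-v)\<close>; this is the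
      recursion of \<open>flat_poly\<close>.\<close>
    have "((\<lambda>u. poly (flat_poly n) (inverse u) * exp (- inverse u)) has_real_derivative
       flat_fun (Suc n) u) (at u)"
      using 1 by (auto intro!: derivative_eq_intros poly_DERIV[THEN DERIV_chain2]
        simp: flat_fun_def field_simps power2_eq_square)
    then show ?thesis
      by (rule has_field_derivative_transform_within_open[of _ _ _ "{0<..}"])
        (use 1 in \<open>auto simp: flat_fun_def\<close>)
  next
    case 2
    have "((\<lambda>u. 0) has_real_derivative flat_fun (Suc n) u) (at u)"
      using 2 by (simp add: flat_fun_def)
    then show ?thesis
      by (rule has_field_derivative_transform_within_open[of _ _ _ "{..<0}"])
        (use 2 in \<open>auto simp: flat_fun_def\<close>)
  next
    case 3
    \<comment> \<open>The factor \<open>[:0, 1:]\<close> is the \<open>1 / h\<close> of the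
      difference quotient, so the right limit is again that of a polynomial times
      \<open>exp(-v)\<close> at infinity.\<close>
    have "((\<lambda>h. poly ([:0, 1:] * flat_poly n) (inverse h) * exp (- inverse h)) \<longlongrightarrow> 0) (at_right 0)"
      using tendsto_poly_mult_exp_minus filterlim_inverse_at_top_right by (rule filterlim_compose)
    then have "((\<lambda>h. flat_fun n h / h) \<longlongrightarrow> 0) (at_right 0)"
      by (rule Lim_transform_eventually)
        (auto simp: flat_fun_def eventually_at_filter divide_inverse)
    moreover have "((\<lambda>h. flat_fun n h / h) \<longlongrightarrow> 0) (at_left 0)"
      by (rule tendsto_eventually) (auto simp: flat_fun_def eventually_at_filter)
    ultimately have "((\<lambda>h. flat_fun n h / h) \<longlongrightarrow> 0) (at 0)"
      by (rule filterlim_split_at_real[rotated])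
    then show ?thesis
      using 3 by (simp add: has_field_derivative_iff flat_fun_def)
  qed
qed

lemma flat_fun_0: "flat_fun 0 u \<ge> 0" "flat_fun 0 u < 1" "u > 0 \<Longrightarrow> flat_fun 0 u > 0" "u \<le> 0 \<Longrightarrow> flat_fun 0 u = 0"
  by (auto simp: flat_fun_def)

section \<open>Smooth extensions with controlled derivatives\<close>

text \<open>\<open>f\<close> is damped by a large power of a smooth function that is \<open>1\<close> on \<open>{a..b}\<close> and less than \<open>1\<close>
  elsewhere. By compactness, that function is bounded away from \<open>1\<close> where \<open>\<bar>f 0 t\<bar> \<ge> S + 1\<close>.\<close>

lemma bounded_extension:
  assumes "c \<le> a" "a \<le> b" "b \<le> d" "deriv_seq {c..d} f" "\<And>t. t \<in> {a..b} \<Longrightarrow> \<bar>f 0 t\<bar> \<le> S"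
  shows "\<exists>h. deriv_seq {c..d} h \<and> (\<forall>t \<in> {a..b}. h 0 t = f 0 t) \<and> (\<forall>t \<in> {c..d}. \<bar>h 0 t\<bar> \<le> S + 1)"
proof -
  \<comment> \<open>At order 0 both flat terms are below 1 and, as \<open>a \<le> b\<close>, at most
    one is nonzero. The sign \<open>(- 1) ^ n\<close> comes from the chain rule for
    \<open>a - t\<close>.\<close>
  define \<psi> where "\<psi> n t = of_bool (n = 0) - flat_fun n (t - b) - (- 1) ^ n * flat_fun n (a - t)" for n t
  have "deriv_seq UNIV \<psi>"
    unfolding deriv_seq_def \<psi>_def
    by (auto intro!: derivative_eq_intros flat_fun_has_derivative[THEN DERIV_chain2])
  then have \<psi>: "deriv_seq {c..d} \<psi>" by (rule deriv_seq_subset) simp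
  have \<psi>01: "0 \<le> \<psi> 0 t" "\<psi> 0 t \<le> 1" for t
    using flat_fun_0[of "t - b"] flat_fun_0[of "a - t"] assms(2)
    by (cases "t \<le> b"; simp add: \<psi>_def)+
  have \<psi>1: "\<psi> 0 t = 1" if "t \<in> {a..b}" for t
    using that by (simp add: \<psi>_def flat_fun_0)
  have \<psi>_less: "\<psi> 0 t < 1" if "t \<notin> {a..b}" for t
    using that flat_fun_0(1,3)[of "t - b"] flat_fun_0(1,3)[of "a - t"] assms(2)
    by (cases "t > b"; simp add: \<psi>_def)
  \<comment> \<open>The margin 1 keeps \<open>Z\<close> disjoint from \<open>{a..b}\<close> and
    leaves a positive target even if \<open>S = 0\<close>.\<close>
  define Z where "Z = {t \<in> {c..d}. S + 1 \<le> \<bar>f 0 t\<bar>}"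
  have cont: "continuous_on {c..d} (f 0)" "continuous_on {c..d} (\<psi> 0)"
    using assms(4) \<psi> deriv_seq_continuous by blast+
  have "Z = {c..d} \<inter> (\<lambda>t. \<bar>f 0 t\<bar>) -` {S + 1..}" by (auto simp: Z_def)
  moreover have "closed ({c..d} \<inter> (\<lambda>t. \<bar>f 0 t\<bar>) -` {S + 1..})"
    by (intro continuous_closed_preimage continuous_on_rabs cont) auto
  ultimately have compact_Z: "compact Z"
    by (metis compact_Icc compact_Int_closed inf.left_idem)
  obtain N where N: "\<And>t. t \<in> Z \<Longrightarrow> \<bar>f 0 t\<bar> * \<psi> 0 t ^ N \<le> S + 1"
  proof (cases "Z = {}")
    case False
    have contZ: "continuous_on Z (\<psi> 0)" "continuous_on Z (\<lambda>t. \<bar>f 0 t\<bar>)"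
      using cont by (auto intro!: continuous_on_rabs elim!: continuous_on_subset simp: Z_def)
    obtain z where z: "z \<in> Z" "\<And>t. t \<in> Z \<Longrightarrow> \<psi> 0 t \<le> \<psi> 0 z"
      using continuous_attains_sup[OF compact_Z False contZ(1)] by blast
    obtain v where v: "v \<in> Z" "\<And>t. t \<in> Z \<Longrightarrow> \<bar>f 0 t\<bar> \<le> \<bar>f 0 v\<bar>"
      using continuous_attains_sup[OF compact_Z False contZ(2)] by blast
    have S: "S \<ge> 0" using assms(5)[of a] assms(2) by auto
    \<comment> \<open>So the maximum of \<open>\<psi> 0\<close> over \<open>Z\<close> is below 1,
      and a single power \<open>N\<close> works for all of \<open>Z\<close>.\<close>
    have "z \<notin> {a..b}" using z(1) assms(5)[of z] by (auto simp: Z_def)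
    then have "(\<lambda>N. \<bar>f 0 v\<bar> * \<psi> 0 z ^ N) \<longlonglongrightarrow> \<bar>f 0 v\<bar> * 0"
      by (intro tendsto_intros LIMSEQ_realpow_zero \<psi>01 \<psi>_less)
    then have "\<forall>\<^sub>F N in sequentially. \<bar>f 0 v\<bar> * \<psi> 0 z ^ N < S + 1"
      by (rule order_tendstoD) (use S in auto)
    then obtain N where N: "\<bar>f 0 v\<bar> * \<psi> 0 z ^ N < S + 1"
      by (auto simp: eventually_sequentially)
    have "\<bar>f 0 t\<bar> * \<psi> 0 t ^ N \<le> \<bar>f 0 v\<bar> * \<psi> 0 z ^ N" if "t \<in> Z" for t
      using z v that \<psi>01 by (intro mult_mono power_mono) auto
    with N show thesis by (intro that[of N]) force
  qed auto
  obtain h where h: "deriv_seq {c..d} h" "\<forall>x. h 0 x = f 0 x * \<psi> 0 x ^ N"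
    using deriv_seq_mult_power[OF assms(4) \<psi>] by blast
  have "\<bar>h 0 t\<bar> \<le> S + 1" if "t \<in> {c..d}" for t
  proof (cases "t \<in> Z")
    case True
    then show ?thesis using N h(2) \<psi>01 by (simp add: abs_mult)
  next
    case False
    have "\<bar>h 0 t\<bar> \<le> \<bar>f 0 t\<bar> * 1"
      unfolding h(2)[rule_format] abs_mult using \<psi>01 by (intro mult_left_mono) (auto simp: power_le_one)
    then show ?thesis using False that by (auto simp: Z_def)
  qed
  then show ?thesis using h \<psi>1 by (intro exI[of _ h]) auto
qed

text \<open>Extending the \<open>m\<close>-th derivative with a controlled supremum and integrating back \<open>m\<close> times
  controls all derivatives up to order \<open>m\<close>.\<close>

lemma controlled_extension:
  assumes "c \<le> a" "a < b" "b \<le> d" "a - c \<le> 1" "d - b \<le> 1" "deriv_seq {c..d} f"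
    and "\<And>k t. t \<in> {a..b} \<Longrightarrow> \<bar>f k t\<bar> \<le> S k"
  shows "\<exists>g. deriv_seq {c..d} g \<and> (\<forall>t \<in> {a..b}. g 0 t = f 0 t) \<and>
    (\<forall>p \<le> m. \<forall>t \<in> {c..d}. \<bar>g p t\<bar> \<le> 1 + (\<Sum>k\<le>m. S k))"
  using assms(6,7)
proof (induction m arbitrary: f S)
  case 0
  then show ?case
    using bounded_extension[of c a b d f "S 0"] assms(1-3) by (auto simp: add.commute)
next
  case (Suc m)
  have S: "S k \<ge> 0" for k using Suc.prems(2)[of a k] assms(2) by auto
  \<comment> \<open>The induction hypothesis extends the derivative of \<open>f\<close>, with the
    bounds \<open>S\<close> shifted by one.\<close>
  have "deriv_seq {c..d} (\<lambda>n. f (Suc n))" using deriv_seq_shift[OF Suc.prems(1), of 1] by simp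
  from Suc.IH[OF this, of "\<lambda>k. S (Suc k)"] Suc.prems(2)[of _ "Suc _"] obtain g where
    g: "deriv_seq {c..d} g" "\<And>t. t \<in> {a..b} \<Longrightarrow> g 0 t = f (Suc 0) t"
      "\<And>p t. p \<le> m \<Longrightarrow> t \<in> {c..d} \<Longrightarrow> \<bar>g p t\<bar> \<le> 1 + (\<Sum>k\<le>m. S (Suc k))"
    by blast
  obtain G where G: "\<And>x. x \<in> {c..d} \<Longrightarrow> (G has_real_derivative g 0 x) (at x within {c..d})"
    using antiderivative_continuous[OF deriv_seq_continuous[OF g(1), of 0]]
    by (metis has_real_derivative_iff_has_vector_derivative)
  \<comment> \<open>The constant of integration makes \<open>H 0\<close> and \<open>f 0\<close>
    agree at \<open>a\<close>; having equal derivatives on \<open>{a..b}\<close>, they then agree on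
    all of it.\<close>
  define H where "H n = (case n of 0 \<Rightarrow> \<lambda>t. G t - G a + f 0 a | Suc k \<Rightarrow> g k)" for n
  have H0: "H 0 t = G t - G a + f 0 a" and HS: "H (Suc n) = g n" for n t by (auto simp: H_def)
  have H: "deriv_seq {c..d} H"
    unfolding deriv_seq_def
  proof (intro allI ballI)
    fix n x assume x: "x \<in> {c..d}"
    show "(H n has_real_derivative H (Suc n) x) (at x within {c..d})"
    proof (cases n)
      case 0
      have "((\<lambda>t. G t - G a + f 0 a) has_real_derivative g 0 x) (at x within {c..d})"
        by (auto intro!: derivative_eq_intros G x)
      then show ?thesis by (simp add: 0 H_def)
    qed (use deriv_seqD[OF g(1) x] HS in simp)
  qed
  have sub: "{a..b} \<subseteq> {c..d}" using assms by auto
  have "\<exists>k. \<forall>x \<in> {a..b}. H 0 x - f 0 x = k"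
  proof (rule has_field_derivative_zero_constant)
    fix x assume x: "x \<in> {a..b}"
    have "(H 0 has_real_derivative f (Suc 0) x) (at x within {a..b})"
      "(f 0 has_real_derivative f (Suc 0) x) (at x within {a..b})"
      using deriv_seqD[OF deriv_seq_subset[OF H sub] x, of 0] g(2)[OF x]
        deriv_seqD[OF deriv_seq_subset[OF Suc.prems(1) sub] x, of 0] by (simp_all add: HS)
    from DERIV_diff[OF this] show "((\<lambda>x. H 0 x - f 0 x) has_real_derivative 0) (at x within {a..b})"
      by simp
  qed simp
  then obtain k where k: "\<And>x. x \<in> {a..b} \<Longrightarrow> H 0 x - f 0 x = k" by blast
  have "k = 0" using k[of a] assms(2) by (simp add: H0)
  then have Hf: "H 0 t = f 0 t" if "t \<in> {a..b}" for t using k[OF that] by simp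
  have sum: "(\<Sum>k\<le>Suc m. S k) = S 0 + (\<Sum>k\<le>m. S (Suc k))" by (rule sum.atMost_Suc_shift)
  let ?B = "1 + (\<Sum>k\<le>m. S (Suc k))"
  have B: "?B \<ge> 0" using S by (simp add: sum_nonneg add_nonneg_nonneg)
  have bound: "\<bar>H 0 t\<bar> \<le> S 0 + ?B" if t: "t \<in> {c..d}" for t
  proof -
    \<comment> \<open>\<open>r\<close> is the point of \<open>{a..b}\<close> nearest to
      \<open>t\<close>. The margins have length at most 1, so the mean value bound adds at most
      \<open>?B\<close>.\<close>
    define r where "r = min (max t a) b"
    have r: "r \<in> {a..b}" "\<bar>t - r\<bar> \<le> 1" using assms t by (auto simp: r_def)
    have "\<bar>H 0 t - H 0 r\<bar> \<le> ?B * \<bar>t - r\<bar>"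
      using field_differentiable_bound[of "{c..d}" "H 0" "H (Suc 0)" ?B t r] deriv_seqD[OF H]
        g(3)[of 0] t r sub by (auto simp: HS)
    also have "\<dots> \<le> ?B * 1" using r B by (intro mult_left_mono) auto
    finally have "\<bar>H 0 t - H 0 r\<bar> \<le> ?B" by simp
    moreover have "\<bar>H 0 r\<bar> \<le> S 0" using Hf Suc.prems(2) r by auto
    ultimately show ?thesis by linarith
  qed
  have "\<bar>H p t\<bar> \<le> 1 + (\<Sum>k\<le>Suc m. S k)" if "p \<le> Suc m" "t \<in> {c..d}" for p t
  proof (cases p)
    case 0
    then show ?thesis using bound[OF that(2)] by (simp add: sum del: sum.atMost_Suc)
  next
    case (Suc k)
    then show ?thesis using g(3)[of k t] that S[of 0] by (simp add: HS sum del: sum.atMost_Suc)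
  qed
  then show ?case using H Hf by blast
qed

section \<open>Multi-index families of partial derivatives\<close>

lemma iter_partial_Cons: "iter_partial (b # bs) f = partial_deriv b (iter_partial bs f)"
  by (simp add: iter_partial_def)

lemma eventually_line_in_open:
  fixes z b :: "'a::euclidean_space"
  assumes "open U" "z \<in> U"
  shows "\<forall>\<^sub>F h in nhds (0::real). z + h *\<^sub>R b \<in> U"
proof -
  have "((\<lambda>h::real. z + h *\<^sub>R b) \<longlongrightarrow> z + 0 *\<^sub>R b) (nhds 0)"
    by (intro tendsto_intros filterlim_ident)
  then show ?thesis using assms by (intro topological_tendstoD) auto
qed

text \<open>\<open>G \<alpha>\<close> plays the role of the partial derivative with multi-index \<open>\<alpha>\<close>.\<close>

lemma iter_partial_family:
  fixes G :: "('a::euclidean_space \<Rightarrow> nat) \<Rightarrow> 'a \<Rightarrow> real"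
  assumes "open U"
    and D: "\<And>\<alpha> b z. b \<in> Basis \<Longrightarrow> z \<in> U \<Longrightarrow>
      ((\<lambda>h. G \<alpha> (z + h *\<^sub>R b)) has_real_derivative G (\<alpha>(b := Suc (\<alpha> b))) z) (at 0)"
    and "bs \<in> lists Basis" "z \<in> U"
  shows "iter_partial bs (G (\<lambda>_. 0)) z = G (count_list bs) z"
  using assms(3,4)
proof (induction bs arbitrary: z rule: list.induct)
  case Nil
  then show ?case by (simp add: iter_partial_def count_list.simps(1)[abs_def])
next
  case (Cons b bs)
  \<comment> \<open>The induction hypothesis holds only on \<open>U\<close>, but a derivative at 0
    sees only small \<open>h\<close>, for which the line stays in \<open>U\<close>.\<close>
  have "\<forall>\<^sub>F h in nhds 0. iter_partial bs (G (\<lambda>_. 0)) (z + h *\<^sub>R b) = G (count_list bs) (z + h *\<^sub>R b)"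
    using eventually_line_in_open[OF assms(1) Cons.prems(2), of b]
    by (rule eventually_mono) (use Cons in auto)
  then have "iter_partial (b # bs) (G (\<lambda>_. 0)) z = deriv (\<lambda>h. G (count_list bs) (z + h *\<^sub>R b)) 0"
    unfolding iter_partial_Cons partial_deriv_def by (rule deriv_cong_ev) simp
  also have "\<dots> = G ((count_list bs)(b := Suc (count_list bs b))) z"
    using D Cons.prems by (intro DERIV_imp_deriv) auto
  also have "(count_list bs)(b := Suc (count_list bs b)) = count_list (b # bs)" by auto
  finally show ?case .
qed

lemma smooth_on_open_family:
  fixes G :: "('a::euclidean_space \<Rightarrow> nat) \<Rightarrow> 'a \<Rightarrow> real"
  assumes "open U"
    and D: "\<And>\<alpha> b z. b \<in> Basis \<Longrightarrow> z \<in> U \<Longrightarrow>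
      ((\<lambda>h. G \<alpha> (z + h *\<^sub>R b)) has_real_derivative G (\<alpha>(b := Suc (\<alpha> b))) z) (at 0)"
    and C: "\<And>\<alpha>. continuous_on U (G \<alpha>)"
  shows "smooth_on_open U (G (\<lambda>_. 0))"
  unfolding smooth_on_open_def
proof (intro conjI ballI assms(1))
  fix bs :: "'a list" assume bs: "bs \<in> lists Basis"
  note eq = iter_partial_family[of U G, OF assms(1) D bs]
  show "continuous_on U (iter_partial bs (G (\<lambda>_. 0)))"
    using C[of "count_list bs"] by (rule continuous_on_eq) (simp add: eq)
  fix z b :: 'a assume zb: "z \<in> U" "b \<in> Basis"
  have "((\<lambda>h. G (count_list bs) (z + h *\<^sub>R b)) has_real_derivative
    G ((count_list bs)(b := Suc (count_list bs b))) z) (at 0)"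
    using D zb by blast
  moreover have "\<forall>\<^sub>F h in nhds 0. iter_partial bs (G (\<lambda>_. 0)) (z + h *\<^sub>R b) = G (count_list bs) (z + h *\<^sub>R b)"
    using eventually_line_in_open[OF assms(1) zb(1), of b] by (rule eventually_mono) (rule eq)
  ultimately have "((\<lambda>h. iter_partial bs (G (\<lambda>_. 0)) (z + h *\<^sub>R b)) has_real_derivative
    G ((count_list bs)(b := Suc (count_list bs b))) z) (at 0)"
    by (subst DERIV_cong_ev) auto
  then show "(\<lambda>h. iter_partial bs (G (\<lambda>_. 0)) (z + h *\<^sub>R b)) differentiable (at 0)"
    using real_differentiable_def by blast
qed

text \<open>Reduces the Gevrey property to exhibiting candidates for all partial derivatives. The
  bounds are asked for on \<open>K\<close> only, so the extension may grow faster outside.\<close>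

lemma gevrey_on_family:
  fixes G :: "('a::euclidean_space \<Rightarrow> nat) \<Rightarrow> 'a \<Rightarrow> real"
  assumes "open U" "K \<subseteq> U"
    and D: "\<And>\<alpha> b z. b \<in> Basis \<Longrightarrow> z \<in> U \<Longrightarrow>
      ((\<lambda>h. G \<alpha> (z + h *\<^sub>R b)) has_real_derivative G (\<alpha>(b := Suc (\<alpha> b))) z) (at 0)"
    and C: "\<And>\<alpha>. continuous_on U (G \<alpha>)"
    and "\<And>z. z \<in> K \<Longrightarrow> G (\<lambda>_. 0) z = y z"
    and "M > 0" "\<And>b. b \<in> Basis \<Longrightarrow> R \<bullet> b > 0"
    and "\<And>\<alpha> z. z \<in> K \<Longrightarrow> \<bar>G \<alpha> z\<bar> \<le> M * (\<Prod>b \<in> Basis. fact (\<alpha> b) powr (s \<bullet> b) / (R \<bullet> b) ^ \<alpha> b)"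
  shows "gevrey_on s K y"
  unfolding gevrey_on_def
proof (intro exI conjI ballI)
  show "smooth_extension K y (G (\<lambda>_. 0))"
    unfolding smooth_extension_def using smooth_on_open_family[of U G] assms by auto
  fix z :: 'a and bs :: "'a list" assume *: "z \<in> K" "bs \<in> lists Basis"
  then have "iter_partial bs (G (\<lambda>_. 0)) z = G (count_list bs) z"
    using assms(2) by (intro iter_partial_family[OF assms(1) D]) auto
  then show "\<bar>iter_partial bs (G (\<lambda>_. 0)) z\<bar> \<le>
      M * (\<Prod>b \<in> Basis. fact (count_list bs b) powr (s \<bullet> b) / (R \<bullet> b) ^ count_list bs b)"
    using assms(8)[OF *(1)] by simp
qed (use assms in auto)

text \<open>The only basis vector of \<open>real\<close> is 1, so the words of directions are
  \<open>replicate n 1\<close>.\<close>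

lemma smooth_on_open_real_deriv_seq:
  fixes Y :: "real \<Rightarrow> real"
  assumes "smooth_on_open U Y"
  shows "deriv_seq U (\<lambda>n. iter_partial (replicate n 1) Y)"
  unfolding deriv_seq_def
proof (intro allI ballI)
  fix n x assume x: "x \<in> U"
  let ?f = "iter_partial (replicate n 1) Y"
  have "(\<lambda>h. ?f (x + h *\<^sub>R 1)) differentiable (at 0)"
    using assms x by (auto simp: smooth_on_open_def)
  then have "((\<lambda>h. ?f (x + h)) has_real_derivative deriv (\<lambda>h. ?f (x + h)) 0) (at 0)"
    by (simp add: DERIV_deriv_iff_real_differentiable)
  then have "(?f has_real_derivative deriv (\<lambda>h. ?f (x + h)) 0) (at x)"
    using DERIV_shift[of ?f _ 0 x] by (simp add: add.commute)
  moreover have "deriv (\<lambda>h. ?f (x + h)) 0 = iter_partial (replicate (Suc n) 1) Y x"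
    by (simp add: iter_partial_Cons partial_deriv_def)
  ultimately show "(?f has_real_derivative iter_partial (replicate (Suc n) 1) Y x) (at x within U)"
    by (metis has_field_derivative_at_within)
qed

text \<open>The margins are capped at 1 to suit the integration in
  \<open>controlled_extension\<close>.\<close>

lemma open_contains_enlarged_interval:
  fixes a b :: real
  assumes "open U" "{a..b} \<subseteq> U" "a \<le> b"
  obtains c d where "c < a" "b < d" "a - c \<le> 1" "d - b \<le> 1" "{c..d} \<subseteq> U"
proof -
  obtain e1 where e1: "e1 > 0" "cball a e1 \<subseteq> U"
    using assms by (meson atLeastAtMost_iff open_contains_cball order_refl subsetD)
  obtain e2 where e2: "e2 > 0" "cball b e2 \<subseteq> U"
    using assms by (meson atLeastAtMost_iff open_contains_cball order_refl subsetD)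
  define c d where "c = a - min e1 1" and "d = b + min e2 1"
  have "x \<in> U" if "x \<in> {c..d}" for x
  proof -
    consider "x < a" | "x \<in> {a..b}" | "x > b" by fastforce
    then show ?thesis
    proof cases
      case 1
      then have "dist a x \<le> e1" using that unfolding c_def dist_real_def by simp linarith
      then show ?thesis using e1(2) by auto
    next
      case 3
      then have "dist b x \<le> e2" using that unfolding d_def dist_real_def by simp linarith
      then show ?thesis using e2(2) by auto
    qed (use assms(2) in auto)
  qed
  then have "{c..d} \<subseteq> U" by blast
  then show thesis using e1(1) e2(1) by (intro that[of c d]) (simp_all add: c_def d_def)
qed

section \<open>Gevrey estimates\<close>

text \<open>Ratio test: consecutive terms have ratio \<open>c / (n + 1) powr a\<close>, which tends
  to 0. The lemma is used with \<open>a = 1 - s / 2\<close>, positive because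
  \<open>s < 2\<close>.\<close>

lemma summable_power_over_fact_powr:
  fixes c a :: real
  assumes "a > 0"
  shows "summable (\<lambda>n. c ^ n / fact n powr a)"
proof -
  obtain N where N: "(2 * \<bar>c\<bar>) powr (1 / a) < real N" using reals_Archimedean2 by blast
  have N: "2 * \<bar>c\<bar> \<le> real (Suc n) powr a" if "n \<ge> N" for n
  proof -
    have "2 * \<bar>c\<bar> = ((2 * \<bar>c\<bar>) powr (1 / a)) powr a"
      using assms by (simp add: powr_powr)
    also have "\<dots> \<le> real (Suc n) powr a"
      using assms N that by (intro powr_mono2) auto
    finally show ?thesis .
  qed
  show ?thesis
  proof (rule summable_ratio_test)
    fix n assume "n \<ge> N"
    then have "\<bar>c\<bar> / real (Suc n) powr a \<le> 1 / 2"
      using N[of n] by (simp add: divide_le_eq del: of_nat_Suc)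
    then have "\<bar>c\<bar> / real (Suc n) powr a * (\<bar>c\<bar> ^ n / fact n powr a) \<le> 1 / 2 * (\<bar>c\<bar> ^ n / fact n powr a)"
      by (intro mult_right_mono) auto
    then show "norm (c ^ Suc n / fact (Suc n) powr a) \<le> 1 / 2 * norm (c ^ n / fact n powr a)"
      by (simp add: powr_mult abs_mult power_abs del: of_nat_Suc)
  qed simp
qed

lemma fact_add_le: "fact (m + n) \<le> (2 ^ (m + n) * fact m * fact n :: real)"
proof -
  have "fact (m + n) = (fact m * fact n * of_nat ((m + n) choose m) :: real)"
    using binomial_fact_lemma[of m "m + n"] by (metis add_diff_cancel_left' le_add1 of_nat_fact of_nat_mult)
  also have "\<dots> \<le> fact m * fact n * 2 ^ (m + n)"
    using binomial_le_pow2[of "m + n" m] 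
    by (intro mult_left_mono) (simp_all flip: of_nat_le_iff)
  finally show ?thesis by (simp add: mult_ac)
qed

lemma fact_powr_div_fact: "fact n powr t / fact n = 1 / (fact n powr (1 - t) :: real)"
  by (simp add: powr_diff)

text \<open>The weight of \<open>i + p\<close> derivatives of \<open>y\<close> is shared among
  \<open>p\<close>, \<open>q\<close> and the summation index \<open>n\<close>. As \<open>i\<close>
  is half of \<open>n + q\<close>, an x-derivative costs only half a derivative of \<open>y\<close>;
  this is the origin of the order \<open>s / 2\<close> in \<open>x\<close>.\<close>

lemma gevrey_weight_split:
  fixes s R :: real
  assumes "s \<ge> 0" "R > 0" "2 * i = n + q"
  shows "fact (i + p) powr s / R ^ (i + p) \<le>
    fact p powr s / (R / 2 powr s) ^ p * (fact q powr (s / 2) / (sqrt R / 2 powr s) ^ q) *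
    ((2 powr s / sqrt R) ^ n * fact n powr (s / 2))"
proof -
  define A where "A = (2::real) powr (s / 2)"
  define r where "r = sqrt R"
  have A: "A > 0" "2 powr s = A ^ 2" by (simp_all add: A_def powr_power)
  have Ai: "A ^ i * A ^ i = A ^ n * A ^ q"
    using assms(3) by (simp add: mult_2 flip: power_add)
  have r: "r > 0" "R = r ^ 2" using assms(2) by (simp_all add: r_def)
  have pow: "(2 ^ k) powr t = (2 powr t) ^ k" for k and t :: real
    by (simp add: powr_powr powr_realpow[symmetric] mult.commute)
  have "fact (i + p) powr s \<le> (2 ^ (i + p) * fact i * fact p) powr s"
    using assms(1) by (intro powr_mono2 fact_add_le) auto
  also have "\<dots> = A ^ (2 * (i + p)) * (fact i * fact i) powr (s / 2) * fact p powr s"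
    by (simp add: powr_mult pow A flip: powr_add power_mult)
  \<comment> \<open>Here \<open>(i!)^2 \<le> (2 * i)! = (n + q)!\<close>, which is then split a
    second time.\<close>
  also have "\<dots> \<le> A ^ (2 * (i + p)) * (2 ^ (n + q) * fact n * fact q) powr (s / 2) * fact p powr s"
    using order_trans[OF square_fact_le_2_fact[of i]] fact_add_le[of n q] assms A
    by (intro mult_right_mono mult_left_mono powr_mono2) auto
  also have "\<dots> = A ^ (2 * p) * fact p powr s * (A ^ (2 * q) * fact q powr (s / 2)) *
      (A ^ (2 * n) * fact n powr (s / 2))"
    using Ai by (simp add: powr_mult pow assms(3) power_add power_mult mult_ac power2_eq_square
        power_mult_distrib flip: A_def)
  finally have "fact (i + p) powr s / R ^ (i + p) \<le>
      A ^ (2 * p) * fact p powr s * (A ^ (2 * q) * fact q powr (s / 2)) *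
      (A ^ (2 * n) * fact n powr (s / 2)) / R ^ (i + p)"
    using assms(2) by (intro divide_right_mono) auto
  moreover have "R ^ (i + p) = R ^ p * r ^ n * r ^ q"
    by (simp add: r power_add assms(3) flip: power_mult)
  ultimately have "fact (i + p) powr s / R ^ (i + p) \<le>
      A ^ (2 * p) * fact p powr s * (A ^ (2 * q) * fact q powr (s / 2)) *
      (A ^ (2 * n) * fact n powr (s / 2)) / (R ^ p * r ^ n * r ^ q)"
    by simp
  also have "\<dots> = fact p powr s / (R / A\<^sup>2) ^ p * (fact q powr (s / 2) / (r / A\<^sup>2) ^ q) *
      ((A\<^sup>2 / r) ^ n * fact n powr (s / 2))"
    unfolding power_mult using A r assms(2) by (simp add: power_divide mult_ac)
  finally show ?thesis by (simp add: A(2) r_def)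
qed

text \<open>This is the \<open>q\<close>-th derivative of \<open>x^(2i) / (2i)!\<close>. Subtraction
  of naturals truncates, so the vanishing derivatives need their own case.\<close>

definition even_monom :: "nat \<Rightarrow> nat \<Rightarrow> real \<Rightarrow> real" where
  "even_monom q i x = (if q \<le> 2 * i then x ^ (2 * i - q) / fact (2 * i - q) else 0)"

lemma even_monom_has_derivative:
  "(even_monom q i has_real_derivative even_monom (Suc q) i x) (at x within S)"
proof (cases "q < 2 * i")
  case True
  then obtain k where k: "2 * i - q = Suc k" "2 * i - Suc q = k" by (metis Suc_diff_Suc)
  have "((\<lambda>x. x ^ Suc k / fact (Suc k)) has_real_derivative x ^ k / fact k) (at x within S)"
    by (auto intro!: derivative_eq_intros simp del: power_Suc of_nat_Suc simp: divide_simps)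
  then show ?thesis using True by (simp add: even_monom_def[abs_def] k)
next
  case False
  then have "q = 2 * i \<or> \<not> q \<le> 2 * i" by auto
  then show ?thesis by (auto simp: even_monom_def[abs_def])
qed

lemma continuous_on_even_monom: "continuous_on S (even_monom q i)"
  by (meson DERIV_continuous_on even_monom_has_derivative)

text \<open>Explains the constant \<open>32 = 4 * 4 * 2\<close>: one 4 absorbs the power of
  \<open>x\<close>, the other the splitting of \<open>(2 * i)!\<close>, and the 2 leaves a geometric
  series.\<close>

lemma even_monom_le:
  assumes "\<bar>x\<bar> \<le> 2"
  shows "\<bar>even_monom q i x\<bar> * (fact (2 * i) / 32 ^ i) \<le> fact q * (1 / 2) ^ i"
proof (cases "q \<le> 2 * i")
  case True
  define n where "n = 2 * i - q"
  have n: "2 * i = n + q" using True by (simp add: n_def)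
  have pow32: "(32::real) ^ i = 2 ^ (2 * i) * 2 ^ (2 * i) * 2 ^ i"
    by (simp add: power_mult flip: power_mult_distrib)
  have "\<bar>x\<bar> ^ n \<le> 2 ^ n" using assms by (intro power_mono) auto
  also have "\<dots> \<le> 2 ^ (2 * i)" using n by (intro power_increasing) auto
  finally have "\<bar>x\<bar> ^ n / fact n * (fact (2 * i) / 32 ^ i) \<le>
      2 ^ (2 * i) / fact n * (2 ^ (2 * i) * fact n * fact q / 32 ^ i)"
    using fact_add_le[of n q] unfolding n by (intro mult_mono divide_right_mono) auto
  also have "\<dots> = fact q * (1 / 2) ^ i"
    unfolding pow32 by (simp add: power_divide)
  finally show ?thesis using True by (simp add: even_monom_def n_def power_abs)
qed (simp add: even_monom_def)

text \<open>With \<open>n = 2 * i - q\<close>, the \<open>n!\<close> below the monomial outweighs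
  the \<open>(n!)^(s/2)\<close> from \<open>gevrey_weight_split\<close>, leaving the exponent
  \<open>1 - s / 2\<close>.\<close>

lemma even_monom_mult_le:
  assumes "s \<ge> 0" "R > 0" "M \<ge> 0" "0 \<le> x" "x \<le> 1" "\<bar>y\<bar> \<le> M * (fact (i + p) powr s / R ^ (i + p))"
  defines "c \<equiv> 2 powr s / sqrt R"
  shows "\<bar>even_monom q i x * y\<bar> \<le>
    M * (fact p powr s / (R / 2 powr s) ^ p * (fact q powr (s / 2) / (sqrt R / 2 powr s) ^ q)) *
    (if q \<le> 2 * i then c ^ (2 * i - q) / fact (2 * i - q) powr (1 - s / 2) else 0)"
proof (cases "q \<le> 2 * i")
  case True
  define n where "n = 2 * i - q"
  define C where "C = fact p powr s / (R / 2 powr s) ^ p * (fact q powr (s / 2) / (sqrt R / 2 powr s) ^ q)"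
  have n: "2 * i = n + q" using True by (simp add: n_def)
  have "x ^ n / fact n * \<bar>y\<bar> \<le> 1 / fact n * \<bar>y\<bar>"
    using assms by (intro mult_right_mono divide_right_mono power_le_one) auto
  also have "\<dots> \<le> 1 / fact n * (M * (C * (c ^ n * fact n powr (s / 2))))"
    using gevrey_weight_split[OF assms(1,2) n, of p] assms(3,6)
    by (intro mult_left_mono order_trans[OF assms(6)]) (auto simp: C_def c_def)
  also have "\<dots> = M * C * c ^ n * (fact n powr (s / 2) / fact n)"
    by simp
  also have "\<dots> = M * C * (c ^ n / fact n powr (1 - s / 2))"
    by (simp add: fact_powr_div_fact)
  finally show ?thesis using True assms(4) by (simp add: even_monom_def abs_mult n_def C_def)
qed (simp add: even_monom_def)

lemma suminf_even_monom_le: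
  fixes f :: "nat \<Rightarrow> real"
  assumes "0 \<le> s" "s < 2" "R > 0" "M \<ge> 0" "0 \<le> x" "x \<le> 1"
    and f: "\<And>i. \<bar>f i\<bar> \<le> M * (fact (i + p) powr s / R ^ (i + p))"
  defines "c \<equiv> 2 powr s / sqrt R"
  shows "\<bar>\<Sum>i. even_monom q i x * f i\<bar> \<le> (M * (\<Sum>n. c ^ n / fact n powr (1 - s / 2))) *
      (fact p powr s / (R / 2 powr s) ^ p * (fact q powr (s / 2) / (sqrt R / 2 powr s) ^ q))"
    and "summable (\<lambda>i. even_monom q i x * f i)"
proof -
  define C where "C = fact p powr s / (R / 2 powr s) ^ p * (fact q powr (s / 2) / (sqrt R / 2 powr s) ^ q)"
  define \<alpha> where "\<alpha> n = c ^ n / fact n powr (1 - s / 2)" for n :: nat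
  define \<beta> where "\<beta> i = (if q \<le> 2 * i then \<alpha> (2 * i - q) else 0)" for i :: nat
  have C: "C \<ge> 0" using assms by (simp add: C_def)
  have \<alpha>: "summable \<alpha>" "\<alpha> n \<ge> 0" for n
    using assms summable_power_over_fact_powr[of "1 - s / 2" c] by (auto simp: \<alpha>_def[abs_def])
  \<comment> \<open>On \<open>q \<le> 2 * i\<close> the map from \<open>i\<close> to
    \<open>2 * i - q\<close> is injective, so these are sums of distinct terms of
    \<open>\<alpha>\<close>; the bound is therefore independent of \<open>q\<close>.\<close>
  have partial: "sum \<beta> {..<N} \<le> suminf \<alpha>" for N
  proof -
    have "sum \<beta> {..<N} = sum \<beta> {i \<in> {..<N}. q \<le> 2 * i}"
      by (rule sum.mono_neutral_right) (auto simp: \<beta>_def)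
    also have "\<dots> = sum \<alpha> ((\<lambda>i. 2 * i - q) ` {i \<in> {..<N}. q \<le> 2 * i})"
      by (subst sum.reindex) (auto simp: inj_on_def \<beta>_def)
    also have "\<dots> \<le> suminf \<alpha>" by (intro sum_le_suminf \<alpha>) auto
    finally show ?thesis .
  qed
  have \<beta>0: "\<beta> i \<ge> 0" for i using \<alpha> by (simp add: \<beta>_def)
  have \<beta>: "summable \<beta>"
    using \<beta>0 partial by (intro bounded_imp_summable[of _ "suminf \<alpha>"])
      (simp_all flip: lessThan_Suc_atMost del: sum.lessThan_Suc)
  have bound: "norm (even_monom q i x * f i) \<le> M * C * \<beta> i" for i
    using even_monom_mult_le[OF assms(1,3-6) f, of q i]
    unfolding C_def \<beta>_def \<alpha>_def c_def real_norm_def .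
  have sum: "summable (\<lambda>i. M * C * \<beta> i)" by (intro summable_mult \<beta>)
  show "summable (\<lambda>i. even_monom q i x * f i)"
    by (rule summable_comparison_test'[OF sum bound])
  have "\<bar>\<Sum>i. even_monom q i x * f i\<bar> \<le> (\<Sum>i. M * C * \<beta> i)"
    using norm_suminf_le[OF bound sum] by simp
  also have "\<dots> = M * C * suminf \<beta>" by (rule suminf_mult[OF \<beta>])
  also have "\<dots> \<le> M * C * suminf \<alpha>"
    using assms(4) C partial by (intro mult_left_mono suminf_le_const \<beta>) auto
  finally show "\<bar>\<Sum>i. even_monom q i x * f i\<bar> \<le> (M * (\<Sum>n. c ^ n / fact n powr (1 - s / 2))) *
      (fact p powr s / (R / 2 powr s) ^ p * (fact q powr (s / 2) / (sqrt R / 2 powr s) ^ q))"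
    by (simp add: C_def \<alpha>_def[abs_def] mult_ac)
qed

text \<open>For fixed \<open>m\<close>, the bound that \<open>controlled_extension\<close> gives for
  the \<open>i\<close>-th coefficient grows like a power times \<open>((2 * i)!)^(s/2)\<close>,
  hence is eventually below \<open>(2 * i)! / 32 ^ i\<close>.\<close>

lemma eventually_gevrey_weight_le:
  fixes s R M :: real
  assumes "0 \<le> s" "s < 2" "R > 0"
  shows "\<forall>\<^sub>F i in sequentially. (1 + (\<Sum>k\<le>m. M * (fact (i + k) powr s / R ^ (i + k)))) * 32 ^ i \<le> fact (2 * i)"
proof -
  define c where "c = 2 powr s / sqrt R"
  have double: "filterlim (\<lambda>i::nat. 2 * i) at_top sequentially"
    by (rule filterlim_subseq) (simp add: strict_mono_def)
  \<comment> \<open>Since \<open>32 \<le> 6^2\<close>, the factor \<open>32 ^ i\<close> fits a power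
    with exponent \<open>2 * i\<close>, like that of \<open>c\<close>.\<close>
  have pow36: "(32::real) ^ i \<le> 6 ^ (2 * i)" for i
    by (simp add: power_mult power_mono)
  have "(\<lambda>i. fact (i + k) powr s / R ^ (i + k) * 32 ^ i / fact (2 * i)) \<longlonglongrightarrow> 0" for k
  proof (rule real_tendsto_sandwich[OF _ _ tendsto_const])
    define C where "C = fact k powr s / (R / 2 powr s) ^ k"
    have C: "C \<ge> 0" using assms by (simp add: C_def)
    have "(\<lambda>n. (c * 6) ^ n / fact n powr (1 - s / 2)) \<longlonglongrightarrow> 0"
      by (rule summable_LIMSEQ_zero[OF summable_power_over_fact_powr]) (use assms in simp)
    then have "(\<lambda>i. C * ((c * 6) ^ (2 * i) / fact (2 * i) powr (1 - s / 2))) \<longlonglongrightarrow> C * 0"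
      by (intro tendsto_mult tendsto_const) (rule filterlim_compose[OF _ double])
    then show "(\<lambda>i. C * ((c * 6) ^ (2 * i) / fact (2 * i) powr (1 - s / 2))) \<longlonglongrightarrow> 0" by simp
    have "fact (i + k) powr s / R ^ (i + k) * 32 ^ i / fact (2 * i) \<le>
        C * ((c * 6) ^ (2 * i) / fact (2 * i) powr (1 - s / 2))" for i
    proof -
      have "fact (i + k) powr s / R ^ (i + k) * 32 ^ i / fact (2 * i) \<le>
          C * (c ^ (2 * i) * fact (2 * i) powr (s / 2)) * 6 ^ (2 * i) / fact (2 * i)"
        using gevrey_weight_split[OF assms(1,3), of i "2 * i" 0 k] C assms(3)
        by (intro divide_right_mono mult_mono pow36) (auto simp: C_def c_def)
      also have "\<dots> = C * (c * 6) ^ (2 * i) * (fact (2 * i) powr (s / 2) / fact (2 * i))"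
        by (simp add: power_mult_distrib)
      also have "\<dots> = C * ((c * 6) ^ (2 * i) / fact (2 * i) powr (1 - s / 2))"
        by (simp add: fact_powr_div_fact)
      finally show ?thesis .
    qed
    then show "\<forall>\<^sub>F i in sequentially. fact (i + k) powr s / R ^ (i + k) * 32 ^ i / fact (2 * i) \<le>
        C * ((c * 6) ^ (2 * i) / fact (2 * i) powr (1 - s / 2))"
      by (intro always_eventually allI)
  qed (use assms in auto)
  moreover have "(\<lambda>i. 32 ^ i / fact (2 * i) :: real) \<longlonglongrightarrow> 0"
  proof (rule real_tendsto_sandwich[OF _ _ tendsto_const])
    show "(\<lambda>i. 6 ^ (2 * i) / fact (2 * i) :: real) \<longlonglongrightarrow> 0"
      using filterlim_compose[OF summable_LIMSEQ_zero[OF summable_exp[of 6]] double]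
      by (simp add: divide_inverse mult.commute)
  qed (auto intro!: always_eventually divide_right_mono pow36)
  ultimately have "(\<lambda>i. 32 ^ i / fact (2 * i) +
      (\<Sum>k\<le>m. M * (fact (i + k) powr s / R ^ (i + k) * 32 ^ i / fact (2 * i)))) \<longlonglongrightarrow> 0 + (\<Sum>k\<le>m. M * 0)"
    by (intro tendsto_add tendsto_sum tendsto_mult tendsto_const)
  then have "\<forall>\<^sub>F i in sequentially. 32 ^ i / fact (2 * i) +
      (\<Sum>k\<le>m. M * (fact (i + k) powr s / R ^ (i + k) * 32 ^ i / fact (2 * i))) < 1"
    by (rule order_tendstoD) simp
  then show ?thesis
  proof (rule eventually_mono)
    fix i assume *: "32 ^ i / fact (2 * i) +
      (\<Sum>k\<le>m. M * (fact (i + k) powr s / R ^ (i + k) * 32 ^ i / fact (2 * i))) < 1"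
    have "(1 + (\<Sum>k\<le>m. M * (fact (i + k) powr s / R ^ (i + k)))) * 32 ^ i / fact (2 * i) =
      32 ^ i / fact (2 * i) + (\<Sum>k\<le>m. M * (fact (i + k) powr s / R ^ (i + k) * 32 ^ i / fact (2 * i)))"
      by (simp add: distrib_right add_divide_distrib sum_distrib_right sum_divide_distrib mult.assoc)
    with * have "(1 + (\<Sum>k\<le>m. M * (fact (i + k) powr s / R ^ (i + k)))) * 32 ^ i / fact (2 * i) < 1"
      by (simp only:)
    then show "(1 + (\<Sum>k\<le>m. M * (fact (i + k) powr s / R ^ (i + k)))) * 32 ^ i \<le> fact (2 * i)"
      by (simp add: divide_less_eq)
  qed
qed

section \<open>The series for theta\<close>

definition heat_series :: "(nat \<Rightarrow> nat \<Rightarrow> real \<Rightarrow> real) \<Rightarrow> nat \<Rightarrow> nat \<Rightarrow> real \<Rightarrow> real \<Rightarrow> real" where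
  "heat_series g p q t x = (\<Sum>i. even_monom q i x * g i p t)"

context
  fixes c d :: real and g :: "nat \<Rightarrow> nat \<Rightarrow> real \<Rightarrow> real"
  assumes g: "\<And>i. deriv_seq {c..d} (g i)"
    and g_le: "\<And>p. \<forall>\<^sub>F i in sequentially. \<forall>t \<in> {c..d}. \<bar>g i p t\<bar> \<le> fact (2 * i) / 32 ^ i"
begin

text \<open>A summable majorant independent of the point, valid from an index depending on
  \<open>p\<close>. It serves the Weierstrass test for every termwise derivative;
  \<open>{-2..2}\<close> contains \<open>{0..1}\<close> in its interior.\<close>

lemma eventually_even_monom_mult_le:
  "\<forall>\<^sub>F i in sequentially. \<forall>z \<in> {c..d} \<times> {-2..2}. norm (even_monom q i (snd z) * g i p (fst z)) \<le> fact q * (1 / 2) ^ i"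
  using g_le[of p]
proof (rule eventually_mono, safe)
  fix i t x assume *: "\<forall>t \<in> {c..d}. \<bar>g i p t\<bar> \<le> fact (2 * i) / 32 ^ i" "t \<in> {c..d}" "x \<in> {-2..2::real}"
  have "norm (even_monom q i x * g i p t) \<le> \<bar>even_monom q i x\<bar> * (fact (2 * i) / 32 ^ i)"
    unfolding real_norm_def abs_mult using * by (intro mult_left_mono) auto
  also have "\<dots> \<le> fact q * (1 / 2) ^ i" using * by (intro even_monom_le) auto
  finally show "norm (even_monom q i (snd (t, x)) * g i p (fst (t, x))) \<le> fact q * (1 / 2) ^ i" by simp
qed

lemma uniform_limit_heat_series:
  "uniform_limit ({c..d} \<times> {-2..2}) (\<lambda>n z. \<Sum>i<n. even_monom q i (snd z) * g i p (fst z))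
     (\<lambda>z. heat_series g p q (fst z) (snd z)) sequentially"
  unfolding heat_series_def
  by (rule Weierstrass_m_test_ev[OF eventually_even_monom_mult_le]) (auto intro!: summable_mult summable_geometric)

lemma summable_heat_series:
  assumes "t \<in> {c..d}" "x \<in> {-2..2}"
  shows "summable (\<lambda>i. even_monom q i x * g i p t)"
proof (rule summable_comparison_test_ev)
  show "\<forall>\<^sub>F i in sequentially. norm (even_monom q i x * g i p t) \<le> fact q * (1 / 2) ^ i"
    using eventually_even_monom_mult_le[of q p] by (rule eventually_mono) (use assms in force)
qed (auto intro!: summable_mult summable_geometric)

lemma continuous_on_heat_series:
  "continuous_on ({c..d} \<times> {-2..2}) (\<lambda>z. heat_series g p q (fst z) (snd z))"
proof (rule uniform_limit_theorem[OF _ uniform_limit_heat_series])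
  have "continuous_on ({c..d} \<times> {-2..2}) (\<lambda>z. even_monom q i (snd z) * g i p (fst z))" for i
    by (intro continuous_intros continuous_on_compose2[OF continuous_on_even_monom[of UNIV]]
        continuous_on_compose2[OF deriv_seq_continuous[OF g]]) auto
  then show "\<forall>\<^sub>F n in sequentially. continuous_on ({c..d} \<times> {-2..2})
      (\<lambda>z. \<Sum>i<n. even_monom q i (snd z) * g i p (fst z))"
    by (intro always_eventually allI continuous_on_sum)
qed simp

text \<open>Termwise differentiation: the series converges pointwise and the series of derivatives
  uniformly. The limit \<open>G\<close> so obtained coincides with the series on
  \<open>{c..d}\<close>.\<close>

lemma heat_series_has_derivative_t:
  assumes "t \<in> {c..d}" "x \<in> {-2..2}"
  shows "((\<lambda>t. heat_series g p q t x) has_real_derivative heat_series g (Suc p) q t x) (at t within {c..d})"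
proof -
  have "uniform_limit {c..d} (\<lambda>n t. \<Sum>i<n. even_monom q i x * g i (Suc p) t)
     (\<lambda>t. heat_series g (Suc p) q t x) sequentially"
    using uniform_limit_compose'[OF uniform_limit_heat_series, of "\<lambda>t. (t, x)" "{c..d}"] assms by auto
  then have "\<exists>G. \<forall>t \<in> {c..d}. (\<lambda>i. even_monom q i x * g i p t) sums G t \<and>
      (G has_real_derivative heat_series g (Suc p) q t x) (at t within {c..d})"
    using assms summable_heat_series
    by (intro has_field_derivative_series[of _ _ "\<lambda>i t. even_monom q i x * g i (Suc p) t"])
      (auto intro!: DERIV_cmult deriv_seqD[OF g])
  then obtain G where G: "\<And>t. t \<in> {c..d} \<Longrightarrow> (\<lambda>i. even_monom q i x * g i p t) sums G t"
    "(G has_real_derivative heat_series g (Suc p) q t x) (at t within {c..d})"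
    using assms by blast
  have "heat_series g p q t x = G t" if "t \<in> {c..d}" for t
    using G(1)[OF that] by (simp add: heat_series_def sums_iff)
  then show ?thesis
    using has_field_derivative_transform_within[OF G(2) zero_less_one assms(1)] by simp
qed

lemma heat_series_has_derivative_x:
  assumes "t \<in> {c..d}" "x \<in> {-2..2}"
  shows "((\<lambda>x. heat_series g p q t x) has_real_derivative heat_series g p (Suc q) t x) (at x within {-2..2})"
proof -
  have "uniform_limit {-2..2} (\<lambda>n x. \<Sum>i<n. even_monom (Suc q) i x * g i p t)
     (\<lambda>x. heat_series g p (Suc q) t x) sequentially"
    using uniform_limit_compose'[OF uniform_limit_heat_series, of "\<lambda>x. (t, x)" "{-2..2}"] assms by auto
  then have "\<exists>G. \<forall>x \<in> {-2..2}. (\<lambda>i. even_monom q i x * g i p t) sums G x \<and>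
      (G has_real_derivative heat_series g p (Suc q) t x) (at x within {-2..2})"
    using assms summable_heat_series
    by (intro has_field_derivative_series[of _ _ "\<lambda>i x. even_monom (Suc q) i x * g i p t"])
      (auto intro!: DERIV_cmult_right even_monom_has_derivative)
  then obtain G where G: "\<And>x. x \<in> {-2..2} \<Longrightarrow> (\<lambda>i. even_monom q i x * g i p t) sums G x"
    "(G has_real_derivative heat_series g p (Suc q) t x) (at x within {-2..2})"
    using assms by blast
  have "heat_series g p q t x = G x" if "x \<in> {-2..2}" for x
    using G(1)[OF that] by (simp add: heat_series_def sums_iff)
  then show ?thesis
    using has_field_derivative_transform_within[OF G(2) zero_less_one assms(2)] by simp
qed

end

section \<open>Diagonal choice of the extended coefficients\<close>

lemma eventually_diagonal:
  fixes Q :: "nat \<Rightarrow> nat \<Rightarrow> bool"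
  assumes "\<And>m. eventually (Q m) sequentially"
  shows "\<exists>\<mu>. \<forall>p. \<forall>\<^sub>F i in sequentially. p \<le> \<mu> i \<and> Q (\<mu> i) i"
proof -
  \<comment> \<open>\<open>\<mu> i\<close> is the largest admissible \<open>m \<le> i\<close>. Once
    \<open>Q p i\<close> and \<open>p \<le> i\<close> hold, the set is nonempty and its maximum is
    at least \<open>p\<close>.\<close>
  define \<mu> where "\<mu> i = Max {m. m \<le> i \<and> Q m i}" for i
  have "p \<le> \<mu> i \<and> Q (\<mu> i) i" if "Q p i" "p \<le> i" for p i
  proof -
    have fin: "finite {m. m \<le> i \<and> Q m i}" by simp
    have "\<mu> i \<in> {m. m \<le> i \<and> Q m i}" unfolding \<mu>_def using that by (intro Max_in fin) auto
    moreover have "p \<le> \<mu> i" unfolding \<mu>_def using that by (intro Max_ge fin) auto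
    ultimately show ?thesis by simp
  qed
  then show ?thesis
    by (intro exI[of _ \<mu>] allI eventually_mono[OF eventually_conj[OF assms eventually_ge_at_top]]) blast
qed

 text \<open>The \<open>i\<close>-th extension controls derivatives up to order
   \<open>\<mu> i\<close>. As \<open>\<mu>\<close> tends to infinity, each fixed order
   \<open>p\<close> is covered for all but finitely many \<open>i\<close>, and these do not affect
   convergence.\<close>

 lemma tame_extensions:
  fixes s R M :: real and y :: "nat \<Rightarrow> real \<Rightarrow> real"
  assumes "0 \<le> s" "s < 2" "R > 0" "c \<le> a" "a < b" "b \<le> d" "a - c \<le> 1" "d - b \<le> 1"
    and y: "deriv_seq {c..d} y" "\<And>k t. t \<in> {a..b} \<Longrightarrow> \<bar>y k t\<bar> \<le> M * (fact k powr s / R ^ k)"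
  obtains g where "\<And>i. deriv_seq {c..d} (g i)" "\<And>i p t. t \<in> {a..b} \<Longrightarrow> g i p t = y (i + p) t"
    "\<And>p. \<forall>\<^sub>F i in sequentially. \<forall>t \<in> {c..d}. \<bar>g i p t\<bar> \<le> fact (2 * i) / 32 ^ i"
proof -
  define S where "S i k = M * (fact (i + k) powr s / R ^ (i + k))" for i k
  obtain \<mu> where \<mu>: "\<And>p. \<forall>\<^sub>F i in sequentially. p \<le> \<mu> i \<and> (1 + sum (S i) {..\<mu> i}) * 32 ^ i \<le> fact (2 * i)"
    using eventually_diagonal[of "\<lambda>m i. (1 + sum (S i) {..m}) * 32 ^ i \<le> fact (2 * i)"]
      eventually_gevrey_weight_le[OF assms(1-3)] unfolding S_def by blast
  have "\<exists>h. deriv_seq {c..d} h \<and> (\<forall>t \<in> {a..b}. h 0 t = y i t) \<and>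
      (\<forall>p \<le> \<mu> i. \<forall>t \<in> {c..d}. \<bar>h p t\<bar> \<le> 1 + sum (S i) {..\<mu> i})" for i
    using controlled_extension[of c a b d "\<lambda>n. y (n + i)" "S i" "\<mu> i"] deriv_seq_shift[OF y(1)] y(2) assms(4-8)
    by (auto simp: S_def add.commute)
  then obtain g where g: "\<And>i. deriv_seq {c..d} (g i)" "\<And>i t. t \<in> {a..b} \<Longrightarrow> g i 0 t = y i t"
    "\<And>i p t. p \<le> \<mu> i \<Longrightarrow> t \<in> {c..d} \<Longrightarrow> \<bar>g i p t\<bar> \<le> 1 + sum (S i) {..\<mu> i}"
    by metis
  show thesis
  proof (rule that[OF g(1)])
    fix i p t assume t: "t \<in> {a..b}"
    have sub: "{a..b} \<subseteq> {c..d}" using assms by auto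
    show "g i p t = y (i + p) t"
      using deriv_seq_unique[OF assms(5) deriv_seq_subset[OF g(1) sub]
          deriv_seq_subset[OF deriv_seq_shift[OF y(1), of i] sub], of i t p] g(2) t
      by (simp add: add.commute)
  next
    fix p
    show "\<forall>\<^sub>F i in sequentially. \<forall>t \<in> {c..d}. \<bar>g i p t\<bar> \<le> fact (2 * i) / 32 ^ i"
      using \<mu>[of p]
    proof (rule eventually_mono, intro ballI)
      fix i t assume "p \<le> \<mu> i \<and> (1 + sum (S i) {..\<mu> i}) * 32 ^ i \<le> fact (2 * i)" "t \<in> {c..d}"
      with g(3)[of p i t] show "\<bar>g i p t\<bar> \<le> fact (2 * i) / 32 ^ i"
        by (intro order_trans[OF g(3)[of p i t]]) (auto simp: pos_le_divide_eq)
    qed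
  qed
qed

 section \<open>Regularity of theta and of the boundary control\<close>

 theorem proposition1:
  fixes s t1 t2 M R :: real and y :: "real \<Rightarrow> real"
  assumes "0 \<le> s" and "s < 2" and "t1 < t2"
    and "smooth_on_compact {t1..t2} y"
    and "M > 0" and "R > 0"
    and "\<And>i t. t \<in> {t1..t2} \<Longrightarrow> \<bar>(deriv_in {t1..t2} ^^ i) y t\<bar> \<le> M * (fact i powr s / R ^ i)"
  shows "(\<forall>t \<in> {t1..t2}. \<forall>x \<in> {0..1}.
            summable (\<lambda>i. x ^ (2 * i) / fact (2 * i) * (deriv_in {t1..t2} ^^ i) y t))
       \<and> gevrey_on (s, s / 2) ({t1..t2} \<times> {0..1}) (theta t1 t2 y)
       \<and> (\<forall>t \<in> {t1..t2}.
            ((\<lambda>x. theta t1 t2 y (t, x)) has_real_derivative control t1 t2 y t) (at 1 within {0..1})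
          \<and> (\<lambda>i. (deriv_in {t1..t2} ^^ Suc i) y t / fact (2 * Suc i - 1)) sums control t1 t2 y t)
       \<and> gevrey_on s {t1..t2} (control t1 t2 y)"
proof -
  obtain Y U where Y: "{t1..t2} \<subseteq> U" "smooth_on_open U Y" "\<And>t. t \<in> {t1..t2} \<Longrightarrow> Y t = y t"
    using assms(4) by (auto simp: smooth_on_compact_def smooth_extension_def)
  have "open U" using Y(2) by (simp add: smooth_on_open_def)
  then obtain c d where cd: "c < t1" "t2 < d" "t1 - c \<le> 1" "d - t2 \<le> 1" "{c..d} \<subseteq> U"
    using open_contains_enlarged_interval[of U t1 t2] Y(1) assms(3) by (metis less_imp_le)
  define D where "D n = iter_partial (replicate n 1) Y" for n
  have D: "deriv_seq {c..d} D"
    unfolding D_def[abs_def] by (rule deriv_seq_subset[OF smooth_on_open_real_deriv_seq[OF Y(2)] cd(5)])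
  have sub: "{t1..t2} \<subseteq> {c..d}" using cd by auto
  have yD: "(deriv_in {t1..t2} ^^ i) y t = D i t" if "t \<in> {t1..t2}" for i t
    using Y(3) that
    by (intro deriv_in_funpow_eq assms(3) deriv_seq_subset[OF D sub])
      (auto simp: D_def iter_partial_def)
  have D_le: "\<bar>D k t\<bar> \<le> M * (fact k powr s / R ^ k)" if "t \<in> {t1..t2}" for k t
    using assms(7)[OF that] yD[OF that] by simp
  obtain g where g: "\<And>i. deriv_seq {c..d} (g i)" "\<And>i p t. t \<in> {t1..t2} \<Longrightarrow> g i p t = D (i + p) t"
    "\<And>p. \<forall>\<^sub>F i in sequentially. \<forall>t \<in> {c..d}. \<bar>g i p t\<bar> \<le> fact (2 * i) / 32 ^ i"
    by (rule tame_extensions[OF assms(1,2,6) less_imp_le[OF cd(1)] assms(3)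
          less_imp_le[OF cd(2)] cd(3,4) D D_le]) blast+
  define F where "F = heat_series g"
  define L where "L = (\<Sum>n. (2 powr s / sqrt R) ^ n / fact n powr (1 - s / 2))"
  have F_le: "\<bar>F p q t x\<bar> \<le> M * L *
      (fact p powr s / (R / 2 powr s) ^ p * (fact q powr (s / 2) / (sqrt R / 2 powr s) ^ q))"
    if "t \<in> {t1..t2}" "0 \<le> x" "x \<le> 1" for p q t x
    unfolding F_def heat_series_def L_def
    by (rule suminf_even_monom_le(1)) (use that assms D_le g(2) in auto)
  \<comment> \<open>The term \<open>n = 0\<close> already gives \<open>L \<ge> 1\<close>; positivity
    is required of the constant in \<open>gevrey_on\<close>.\<close>
  have "1 / fact 0 powr (1 - s / 2) \<le> L"
    using sum_le_suminf[OF summable_power_over_fact_powr[of "1 - s / 2" "2 powr s / sqrt R"], of "{0}"] assms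
    by (auto simp: L_def)
  then have L: "L > 0" by simp
  note smooth = heat_series_has_derivative_t[OF g(1,3), folded F_def]
    heat_series_has_derivative_x[OF g(1,3), folded F_def]
    continuous_on_heat_series[OF g(1,3), folded F_def]
  have dt: "((\<lambda>h. F p q (t + h) x) has_real_derivative F (Suc p) q t x) (at 0)"
    if "t \<in> {c<..<d}" "x \<in> {-2<..<2}" for p q t x
  proof -
    have "((\<lambda>t. F p q t x) has_real_derivative F (Suc p) q t x) (at t within {c..d})"
      using that by (intro smooth(1)) auto
    then have "((\<lambda>t. F p q t x) has_real_derivative F (Suc p) q t x) (at t)"
      using that at_within_interior[of t "{c..d}"] by simp
    then show ?thesis
      using DERIV_shift[of "\<lambda>t. F p q t x" _ 0 t] by (simp add: add.commute)
  qed
  have dx_at: "((\<lambda>x. F p q t x) has_real_derivative F p (Suc q) t x) (at x)"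
    if "t \<in> {c<..<d}" "x \<in> {-2<..<2}" for p q t x
  proof -
    have "((\<lambda>x. F p q t x) has_real_derivative F p (Suc q) t x) (at x within {-2..2})"
      using that by (intro smooth(2)) auto
    then show ?thesis
      using that at_within_interior[of x "{-2..2}"] by simp
  qed
  have dx: "((\<lambda>h. F p q t (x + h)) has_real_derivative F p (Suc q) t x) (at 0)"
    if "t \<in> {c<..<d}" "x \<in> {-2<..<2}" for p q t x
    using DERIV_shift[of "\<lambda>x. F p q t x" _ 0 x] dx_at[OF that, of p q] by (simp add: add.commute)
  \<comment> \<open>On \<open>{t1..t2}\<close> the extended coefficients are the derivatives of
    \<open>y\<close>, so \<open>F 0 0\<close> extends theta.\<close>
  have theta: "theta t1 t2 y (t, x) = F 0 0 t x" if "t \<in> {t1..t2}" for t x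
    using that by (simp add: theta_def F_def heat_series_def yD g(2) even_monom_def)
  have theta_deriv: "((\<lambda>x. theta t1 t2 y (t, x)) has_real_derivative F 0 1 t 1) (at 1 within {0..1})"
    if "t \<in> {t1..t2}" for t
  proof -
    have "(F 0 0 t has_real_derivative F 0 1 t 1) (at 1 within {0..1})"
      using dx_at[of t 1 0 0] that cd by (auto intro: has_field_derivative_at_within)
    then show ?thesis by (simp add: theta[OF that])
  qed
  have control: "control t1 t2 y t = F 0 1 t 1" if "t \<in> {t1..t2}" for t
    unfolding control_def by (rule deriv_in_eq[OF _ _ theta_deriv[OF that]]) auto
  have Basis2: "Basis = {(1, 0), (0, 1) :: real \<times> real}"
    by (auto simp: Basis_prod_def)
  \<comment> \<open>The orders \<open>p\<close> and \<open>q\<close> are read off the multi-index at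
    the two basis vectors.\<close>
  have "gevrey_on (s, s / 2) ({t1..t2} \<times> {0..1}) (theta t1 t2 y)"
  proof (rule gevrey_on_family[where U = "{c<..<d} \<times> {-2<..<2}" and M = "M * L"
        and R = "(R / 2 powr s, sqrt R / 2 powr s)"
        and G = "\<lambda>\<alpha> z. F (\<alpha> (1, 0)) (\<alpha> (0, 1)) (fst z) (snd z)"])
    show "open ({c<..<d} \<times> {-2<..<2::real})" by (intro open_Times) auto
    show "{t1..t2} \<times> {0..1} \<subseteq> {c<..<d} \<times> {-2<..<2::real}" using cd by auto
    show "continuous_on ({c<..<d} \<times> {-2<..<2}) (\<lambda>z. F (\<alpha> (1, 0)) (\<alpha> (0, 1)) (fst z) (snd z))"
      for \<alpha> :: "real \<times> real \<Rightarrow> nat"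
      by (rule continuous_on_subset[OF smooth(3)]) auto
    show "((\<lambda>h. F (\<alpha> (1, 0)) (\<alpha> (0, 1)) (fst (z + h *\<^sub>R b)) (snd (z + h *\<^sub>R b))) has_real_derivative
        F ((\<alpha>(b := Suc (\<alpha> b))) (1, 0)) ((\<alpha>(b := Suc (\<alpha> b))) (0, 1)) (fst z) (snd z)) (at 0)"
      if b: "b \<in> Basis" and z: "z \<in> {c<..<d} \<times> {-2<..<2}" for \<alpha> b z
    proof -
      have z': "fst z \<in> {c<..<d}" "snd z \<in> {-2<..<2}" using z by auto
      from b consider "b = (1, 0)" | "b = (0, 1)" unfolding Basis2 by blast
      then show ?thesis
        by cases (use dt[OF z', of "\<alpha> (1, 0)" "\<alpha> (0, 1)"] dx[OF z', of "\<alpha> (1, 0)" "\<alpha> (0, 1)"] in simp_all)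
    qed
    show "F 0 0 (fst z) (snd z) = theta t1 t2 y z" if "z \<in> {t1..t2} \<times> {0..1}" for z
      using theta[of "fst z" "snd z"] that by auto
    show "(R / 2 powr s, sqrt R / 2 powr s) \<bullet> b > 0" if "b \<in> Basis" for b
      using that assms(6) unfolding Basis2 by auto
    show "\<bar>F (\<alpha> (1, 0)) (\<alpha> (0, 1)) (fst z) (snd z)\<bar> \<le> M * L *
        (\<Prod>b\<in>Basis. fact (\<alpha> b) powr ((s, s / 2) \<bullet> b) / ((R / 2 powr s, sqrt R / 2 powr s) \<bullet> b) ^ \<alpha> b)"
      if "z \<in> {t1..t2} \<times> {0..1}" for \<alpha> z
      using F_le[of "fst z" "snd z" "\<alpha> (1, 0)" "\<alpha> (0, 1)"] that unfolding Basis2 by auto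
  qed (use assms(5) L in simp)
  \<comment> \<open>Only \<open>t\<close> varies, with \<open>q = 1\<close> and \<open>x = 1\<close>
    fixed; the factor of the bound for \<open>q = 1\<close> is \<open>2 powr s / sqrt R\<close> and
    joins the constant.\<close>
  moreover have "gevrey_on s {t1..t2} (control t1 t2 y)"
  proof (rule gevrey_on_family[where U = "{c<..<d}" and M = "M * L * (2 powr s / sqrt R)"
        and R = "R / 2 powr s"
        and G = "\<lambda>\<alpha> t. F (\<alpha> 1) 1 t 1"])
    show "continuous_on {c<..<d} (\<lambda>t. F (\<alpha> 1) 1 t 1)" for \<alpha> :: "real \<Rightarrow> nat"
    proof -
      have "continuous_on {c<..<d} (\<lambda>t. F (\<alpha> 1) 1 (fst (t, 1 :: real)) (snd (t, 1 :: real)))"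
        by (rule continuous_on_compose2[OF smooth(3)]) (auto intro!: continuous_intros)
      then show ?thesis by simp
    qed
    show "\<bar>F (\<alpha> 1) 1 t 1\<bar> \<le> M * L * (2 powr s / sqrt R) *
        (\<Prod>b\<in>Basis. fact (\<alpha> b) powr (s \<bullet> b) / ((R / 2 powr s) \<bullet> b) ^ \<alpha> b)"
      if "t \<in> {t1..t2}" for \<alpha> t
      using F_le[OF that, of 1 "\<alpha> 1" 1] by (simp add: mult_ac)
  qed (use assms cd L control dt in auto)
  moreover have "summable (\<lambda>i. x ^ (2 * i) / fact (2 * i) * (deriv_in {t1..t2} ^^ i) y t)"
    if "t \<in> {t1..t2}" "x \<in> {0..1}" for t x
    using summable_heat_series[OF g(1,3), of t x 0 0] that sub by (auto simp: even_monom_def yD g(2))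
  moreover have "(\<lambda>i. (deriv_in {t1..t2} ^^ Suc i) y t / fact (2 * Suc i - 1)) sums control t1 t2 y t"
    if t: "t \<in> {t1..t2}" for t
  proof -
    have "(\<lambda>i. even_monom 1 i 1 * g i 0 t) sums F 0 1 t 1"
      using summable_heat_series[OF g(1,3), of t 1 1 0] t sub
      by (auto simp: F_def heat_series_def intro: summable_sums)
    \<comment> \<open>The term \<open>i = 0\<close> is constant in \<open>x\<close>, so its
      derivative vanishes and the sum starts at 1.\<close>
    then have "(\<lambda>i. even_monom 1 (Suc i) 1 * g (Suc i) 0 t) sums F 0 1 t 1"
      by (subst sums_Suc_iff) (simp add: even_monom_def)
    then show ?thesis
      using t by (simp add: control even_monom_def g(2) yD[symmetric] del: funpow.simps)
  qed
  ultimately show ?thesis using theta_deriv control by auto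
qed

end
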